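(* Let $2\le r<\infty$, $2^{r-1}\le n\le2^r-1$, let $f:\mathbf R^n\to\mathcal A_r$ be an original, $b\in\mathbf R$, and let $u$ be either the Cartesian kernel (C) or the spherical kernel (S). Then $$\mathcal F^n(e^{b(t_1+\dots+t_n)}f(t),u;p;\zeta)=\mathcal F^n(f(t),u;p-b;\zeta)$$ for each $p$ with $a_{-1}+b>\mathrm{Re}(p)>a_1+b$, where $a_1=a_1(f)$, $a_{-1}=a_{-1}(f)$.
   Context: Cayley–Dickson algebras: $\mathcal A_0=\mathbf R$ and $\mathcal A_{r+1}=\mathcal A_r\oplus\mathcal A_r\mathbf l$ with $(\xi+\eta\mathbf l)(\gamma+\delta\mathbf l)=(\xi\gamma-\delta^*\eta)+(\delta\xi+\eta\gamma^* )\mathbf l$, $(\xi+\eta\mathbf l)^*=\xi^*-\eta\mathbf l$. The standard basis of $\mathcal A_r$ is $i_0=1,i_1,\dots,i_{2^r-1}$, with $i_j^2=-1$, $i_ji_k=-i_ki_j$ for $j\ne k$, $j,k\ge1$. $\mathrm{Re}(z)=(z+z^* )/2$, $|z|^2=zz^*$, $\exp(z)=\sum_kz^k/k!$. Write $p=\sum_jp_ji_j$, $\zeta=\sum_j\zeta_ji_j$ with real $p_j,\zeta_j$. When $n<2^r-1$ one puts $p_m=\zeta_m=t_m=0$ for $m>n$. Originals: $f:\mathbf R^n\to\mathcal A_r$ is an original if (1) $f$ is continuous almost everywhere for the Lebesgue measure; (2) each partial function $t_j\mapsto f(t)$ has on each finite interval only finitely many discontinuities, all of the first kind; (3) each partial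 function $g_j(t_j)=f(t)$ satisfies, except possibly at its discontinuities of the first kind, a Hölder condition $|g_j(t_j+h)-g_j(t_j)|\le A_j|h|^{\alpha_j}$ for $|h|<\delta_j$, with constants $0<\alpha_j\le1$, $A_j,\delta_j>0$ (for the given $t$); (4) there are real $a_1(f),a_{-1}(f)$ and constants $C_v>0$ such that for each $v\in\{-1,1\}^n$, $|f(t)|<C_v\exp(\sum_ja_{v_j}t_j)$ whenever $v_jt_j\ge0$ for all $j$. Kernels: (C) Cartesian: $u(p,t;\zeta)=p_0(t_1+\dots+t_n)+\sum_{j=1}^np_jt_ji_j+\zeta$. (S) Spherical: with $s_j=t_j+\dots+t_n$, $K=2^r-1$, $\phi_j=p_js_j+\zeta_j$: $u=p_0s_1+M+\zeta_0$, $M=\phi_1[i_1\cos\phi_2+i_2\sin\phi_2\cos\phi_3+\dots+i_{K-1}\sin\phi_2\cdots\sin\phi_{K-1}\cos\phi_K+i_K\sin\phi_2\cdots\sin\phi_K]$. Transform: $\mathcal F^n(f(t),u;p;\zeta)=\int_{\mathbf R^n}f(t)\exp(-u(p,t;\zeta))\,dt$. *)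

theory Defs
  imports "HOL-Analysis.Analysis"
begin

section \<open>Cayley--Dickson algebras\<close>

text \<open>
  The algebra \<open>A\<^sub>r\<close> is realised on real sequences vanishing from index \<open>2 ^ r\<close> on; \<open>z k\<close> is the
  coordinate of \<open>z\<close> at the basis element \<open>i\<^sub>k\<close>.  The doubling \<open>\<xi> + \<eta> l\<close> of \<open>\<xi>, \<eta> \<in> A\<^sub>r\<close> puts the
  coordinates of \<open>\<eta>\<close> at positions \<open>2 ^ r, \<dots>, 2 ^ (r + 1) - 1\<close>, so that \<open>l\<close> is the basis element with
  index \<open>2 ^ r\<close> and the basis element with index \<open>2 ^ r + k\<close> is \<open>i\<^sub>k l\<close>.  The product topology of
  \<^typ>\<open>nat \<Rightarrow> real\<close> induces the Euclidean topology on \<open>A\<^sub>r\<close>.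
\<close>

type_synonym cd = "nat \<Rightarrow> real"

definition cd_carrier :: "nat \<Rightarrow> cd set" where
  "cd_carrier r = {z. \<forall>k\<ge>2 ^ r. z k = 0}"

definition cd_basis :: "nat \<Rightarrow> cd" where
  "cd_basis j = (\<lambda>k. if k = j then 1 else 0)"

definition cd_join :: "nat \<Rightarrow> cd \<Rightarrow> cd \<Rightarrow> cd" where
  "cd_join r \<xi> \<eta> = (\<lambda>k. if k < 2 ^ r then \<xi> k else if k < 2 ^ Suc r then \<eta> (k - 2 ^ r) else 0)"

definition cd_low :: "nat \<Rightarrow> cd \<Rightarrow> cd" where
  "cd_low r z = (\<lambda>k. if k < 2 ^ r then z k else 0)"

definition cd_high :: "nat \<Rightarrow> cd \<Rightarrow> cd" where
  "cd_high r z = (\<lambda>k. if k < 2 ^ r then z (2 ^ r + k) else 0)"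

fun cd_conj :: "nat \<Rightarrow> cd \<Rightarrow> cd" where
  "cd_conj 0 z = z"
| "cd_conj (Suc r) z = cd_join r (cd_conj r (cd_low r z)) (\<lambda>k. - cd_high r z k)"

fun cd_mult :: "nat \<Rightarrow> cd \<Rightarrow> cd \<Rightarrow> cd" where
  "cd_mult 0 x y = (\<lambda>k. if k = 0 then x 0 * y 0 else 0)"
| "cd_mult (Suc r) x y =
    (let \<xi> = cd_low r x; \<eta> = cd_high r x; \<gamma> = cd_low r y; \<delta> = cd_high r y
     in cd_join r (\<lambda>k. cd_mult r \<xi> \<gamma> k - cd_mult r (cd_conj r \<delta>) \<eta> k)
                  (\<lambda>k. cd_mult r \<delta> \<xi> k + cd_mult r \<eta> (cd_conj r \<gamma>) k))"

text \<open>
  The elements \<open>(z + z\<^sup>*) / 2\<close> and \<open>z z\<^sup>*\<close> are real multiples of \<open>i\<^sub>0 = 1\<close> (see \<open>cd_Re_eq\<close> and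
  \<open>cd_mult_conj\<close> below); as real numbers they are given by their coordinate at index 0.
\<close>

definition cd_Re :: "nat \<Rightarrow> cd \<Rightarrow> real" where
  "cd_Re r z = (z 0 + cd_conj r z 0) / 2"

definition cd_norm :: "nat \<Rightarrow> cd \<Rightarrow> real" where
  "cd_norm r z = sqrt (cd_mult r z (cd_conj r z) 0)"

primrec cd_power :: "nat \<Rightarrow> cd \<Rightarrow> nat \<Rightarrow> cd" where
  "cd_power r z 0 = cd_basis 0"
| "cd_power r z (Suc m) = cd_mult r z (cd_power r z m)"

definition cd_exp :: "nat \<Rightarrow> cd \<Rightarrow> cd" where
  "cd_exp r z = (\<lambda>k. \<Sum>m. cd_power r z m k / fact m)"

lemma cd_join_low_high:
  assumes "z \<in> cd_carrier (Suc r)"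
  shows "cd_join r (cd_low r z) (cd_high r z) = z"
  using assms by (auto simp: cd_join_def cd_low_def cd_high_def cd_carrier_def fun_eq_iff not_less)

lemma cd_low_join [simp]: "\<xi> \<in> cd_carrier r \<Longrightarrow> cd_low r (cd_join r \<xi> \<eta>) = \<xi>"
  by (auto simp: cd_join_def cd_low_def cd_carrier_def fun_eq_iff not_less)

lemma cd_high_join [simp]: "\<eta> \<in> cd_carrier r \<Longrightarrow> cd_high r (cd_join r \<xi> \<eta>) = \<eta>"
  by (auto simp: cd_join_def cd_high_def cd_carrier_def fun_eq_iff not_less)

lemma cd_low_carrier [simp]: "cd_low r z \<in> cd_carrier r"
  by (auto simp: cd_low_def cd_carrier_def)

lemma cd_high_carrier [simp]: "cd_high r z \<in> cd_carrier r"
  by (auto simp: cd_high_def cd_carrier_def)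

lemma cd_conj_eq:
  assumes "z \<in> cd_carrier r"
  shows "cd_conj r z = (\<lambda>k. if k = 0 then z 0 else - z k)"
  using assms
proof (induction r arbitrary: z)
  case 0
  then show ?case by (auto simp: cd_carrier_def fun_eq_iff)
next
  case (Suc r)
  show ?case
  proof
    fix k
    have "cd_conj r (cd_low r z) = (\<lambda>k. if k = 0 then cd_low r z 0 else - cd_low r z k)"
      by (rule Suc.IH) simp
    then show "cd_conj (Suc r) z k = (if k = 0 then z 0 else - z k)"
      using Suc.prems by (auto simp: cd_join_def cd_low_def cd_high_def cd_carrier_def)
  qed
qed

lemma cd_Re_eq:
  assumes "z \<in> cd_carrier r"
  shows "(z k + cd_conj r z k) / 2 = cd_Re r z * cd_basis 0 k"
  using assms by (simp add: cd_conj_eq cd_Re_def cd_basis_def)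

lemma cd_conj_carrier [simp]: "z \<in> cd_carrier r \<Longrightarrow> cd_conj r z \<in> cd_carrier r"
  by (simp add: cd_conj_eq) (simp add: cd_carrier_def)

lemma cd_conj_conj [simp]: "z \<in> cd_carrier r \<Longrightarrow> cd_conj r (cd_conj r z) = z"
  using cd_conj_eq[OF cd_conj_carrier[of z r]] cd_conj_eq[of z r] by auto

lemma cd_mult_carrier [simp]: "cd_mult r x y \<in> cd_carrier r"
  by (cases r) (auto simp: cd_carrier_def cd_join_def Let_def)

lemma cd_mult_minus:
  assumes "x \<in> cd_carrier r" "y \<in> cd_carrier r"
  shows "cd_mult r (\<lambda>k. - x k) y = (\<lambda>k. - cd_mult r x y k)"
    and "cd_mult r x (\<lambda>k. - y k) = (\<lambda>k. - cd_mult r x y k)"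
proof -
  have "cd_mult r (\<lambda>k. - x k) y = (\<lambda>k. - cd_mult r x y k) \<and>
        cd_mult r x (\<lambda>k. - y k) = (\<lambda>k. - cd_mult r x y k)"
    if "x \<in> cd_carrier r" "y \<in> cd_carrier r" for x y
    using that
  proof (induction r arbitrary: x y)
    case 0
    then show ?case by (auto simp: fun_eq_iff)
  next
    case (Suc r)
    have lo: "cd_low r (\<lambda>k. - z k) = (\<lambda>k. - cd_low r z k)" for z
      by (auto simp: cd_low_def)
    have hi: "cd_high r (\<lambda>k. - z k) = (\<lambda>k. - cd_high r z k)" for z
      by (auto simp: cd_high_def)
    have neg: "(\<lambda>k. - z k) \<in> cd_carrier r" if "z \<in> cd_carrier r" for z
      using that by (auto simp: cd_carrier_def)
    have cj: "cd_conj r (\<lambda>k. - z k) = (\<lambda>k. - cd_conj r z k)" if "z \<in> cd_carrier r" for z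
      using neg[OF that] that by (auto simp: cd_conj_eq fun_eq_iff)
    have 1: "cd_mult r (\<lambda>k. - x k) y = (\<lambda>k. - cd_mult r x y k)"
      and 2: "cd_mult r x (\<lambda>k. - y k) = (\<lambda>k. - cd_mult r x y k)"
      if "x \<in> cd_carrier r" "y \<in> cd_carrier r" for x y
      using Suc.IH[OF that] by auto
    show ?case
      by (auto simp: fun_eq_iff Let_def lo hi cj 1 2 cd_join_def)
  qed
  then show "cd_mult r (\<lambda>k. - x k) y = (\<lambda>k. - cd_mult r x y k)"
    and "cd_mult r x (\<lambda>k. - y k) = (\<lambda>k. - cd_mult r x y k)"
    using assms by blast+
qed

lemma cd_mult_conj:
  assumes "z \<in> cd_carrier r"
  shows "cd_mult r z (cd_conj r z) = (\<lambda>k. (\<Sum>j<2 ^ r. (z j)\<^sup>2) * cd_basis 0 k)"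
    and "cd_mult r (cd_conj r z) z = (\<lambda>k. (\<Sum>j<2 ^ r. (z j)\<^sup>2) * cd_basis 0 k)"
proof -
  have "cd_mult r z (cd_conj r z) = (\<lambda>k. (\<Sum>j<2 ^ r. (z j)\<^sup>2) * cd_basis 0 k) \<and>
        cd_mult r (cd_conj r z) z = (\<lambda>k. (\<Sum>j<2 ^ r. (z j)\<^sup>2) * cd_basis 0 k)"
    using assms
  proof (induction r arbitrary: z)
    case 0
    then show ?case
      by (auto simp: fun_eq_iff cd_basis_def power2_eq_square)
  next
    case (Suc r)
    define \<xi> \<eta> where "\<xi> = cd_low r z" and "\<eta> = cd_high r z"
    have c: "\<xi> \<in> cd_carrier r" "\<eta> \<in> cd_carrier r" "(\<lambda>k. - \<eta> k) \<in> cd_carrier r"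
      using cd_high_carrier[of r z] by (auto simp: \<xi>_def \<eta>_def cd_carrier_def cd_low_def)
    have lh: "cd_low r (cd_conj (Suc r) z) = cd_conj r \<xi>"
      "cd_high r (cd_conj (Suc r) z) = (\<lambda>k. - \<eta> k)"
      using c by (auto simp: \<xi>_def [symmetric] \<eta>_def [symmetric])
    have cn: "cd_conj r (\<lambda>k. - \<eta> k) = (\<lambda>k. - cd_conj r \<eta> k)"
      using c by (auto simp: cd_conj_eq)
    have split: "(\<Sum>j<m + k. g j) = (\<Sum>j<m. g j) + (\<Sum>j<k. g (m + j))" for m k and g :: "nat \<Rightarrow> real"
      by (induction k) (simp_all add: add.assoc)
    have s: "(\<Sum>j<2 ^ Suc r. (z j)\<^sup>2) = (\<Sum>j<2 ^ r. (\<xi> j)\<^sup>2) + (\<Sum>j<2 ^ r. (\<eta> j)\<^sup>2)"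
      using split[of "\<lambda>j. (z j)\<^sup>2" "2 ^ r" "2 ^ r"]
      by (simp add: \<xi>_def \<eta>_def cd_low_def cd_high_def mult_2)
    note ih = Suc.IH[OF c(1)] Suc.IH[OF c(2)]
    have 1: "cd_mult (Suc r) z (cd_conj (Suc r) z) =
      (\<lambda>k. (\<Sum>j<2 ^ Suc r. (z j)\<^sup>2) * cd_basis 0 k)"
      unfolding s using c ih
      by (simp del: cd_conj.simps add: Let_def lh \<xi>_def [symmetric] \<eta>_def [symmetric] cn cd_mult_minus)
         (auto simp: fun_eq_iff cd_join_def cd_basis_def)
    have 2: "cd_mult (Suc r) (cd_conj (Suc r) z) z =
      (\<lambda>k. (\<Sum>j<2 ^ Suc r. (z j)\<^sup>2) * cd_basis 0 k)"
      unfolding s using c ih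
      by (simp del: cd_conj.simps add: Let_def lh \<xi>_def [symmetric] \<eta>_def [symmetric] cn cd_mult_minus)
         (auto simp: fun_eq_iff cd_join_def cd_basis_def)
    show ?case using 1 2 by blast
  qed
  then show "cd_mult r z (cd_conj r z) = (\<lambda>k. (\<Sum>j<2 ^ r. (z j)\<^sup>2) * cd_basis 0 k)"
    and "cd_mult r (cd_conj r z) z = (\<lambda>k. (\<Sum>j<2 ^ r. (z j)\<^sup>2) * cd_basis 0 k)"
    by blast+
qed

lemma cd_norm_eq:
  assumes "z \<in> cd_carrier r"
  shows "cd_norm r z = sqrt (\<Sum>j<2 ^ r. (z j)\<^sup>2)"
  using assms by (simp add: cd_norm_def cd_mult_conj cd_basis_def)


section \<open>Originals\<close>

text \<open>
  Points of \<open>\<real>\<^sup>n\<close> are functions \<open>t\<close> with coordinates \<open>t 1, \<dots>, t n\<close> (and the value \<^const>\<open>undefined\<close>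
  elsewhere).  The measure is completed, since a function that is continuous almost everywhere is
  Lebesgue measurable but not Borel measurable in general.
\<close>

definition euclid :: "nat \<Rightarrow> (nat \<Rightarrow> real) set" where
  "euclid n = {1..n} \<rightarrow>\<^sub>E UNIV"

definition lebesgue_n :: "nat \<Rightarrow> (nat \<Rightarrow> real) measure" where
  "lebesgue_n n = completion (PiM {1..n} (\<lambda>_. lborel))"

definition discont_first_kind :: "(real \<Rightarrow> cd) \<Rightarrow> real \<Rightarrow> bool" where
  "discont_first_kind g x \<longleftrightarrow>
     \<not> isCont g x \<and> (\<exists>l. (g \<longlongrightarrow> l) (at_left x)) \<and> (\<exists>l. (g \<longlongrightarrow> l) (at_right x))"

text \<open>
  \<open>original r n a f\<close>: the function \<open>f\<close> is an original with growth exponents \<open>a\<^sub>1(f) = a 1\<close> and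
  \<open>a\<^sub>-\<^sub>1(f) = a (-1)\<close>.  The constants of the Hoelder condition may depend on the point \<open>t\<close>.
\<close>

definition original :: "nat \<Rightarrow> nat \<Rightarrow> (int \<Rightarrow> real) \<Rightarrow> ((nat \<Rightarrow> real) \<Rightarrow> cd) \<Rightarrow> bool" where
  "original r n a f \<longleftrightarrow>
     (\<forall>t\<in>euclid n. f t \<in> cd_carrier r) \<and>
     (AE t in lebesgue_n n. continuous (at t within euclid n) f) \<and>
     (\<forall>t\<in>euclid n. \<forall>j\<in>{1..n}.
        let g = (\<lambda>x. f (t(j := x))) in
        (\<forall>c d. finite {x\<in>{c..d}. \<not> isCont g x}) \<and>
        (\<forall>x. \<not> isCont g x \<longrightarrow> discont_first_kind g x)) \<and>
     (\<forall>t\<in>euclid n. \<forall>j\<in>{1..n}.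
        let g = (\<lambda>x. f (t(j := x))) in
        \<not> discont_first_kind g (t j) \<longrightarrow>
        (\<exists>\<alpha> A \<delta>. 0 < \<alpha> \<and> \<alpha> \<le> 1 \<and> 0 < A \<and> 0 < \<delta> \<and>
           (\<forall>h. \<bar>h\<bar> < \<delta> \<longrightarrow> cd_norm r (\<lambda>k. g (t j + h) k - g (t j) k) \<le> A * \<bar>h\<bar> powr \<alpha>))) \<and>
     (\<forall>v \<in> {1..n} \<rightarrow>\<^sub>E {-1, 1}. \<exists>C>0. \<forall>t\<in>euclid n.
        (\<forall>j\<in>{1..n}. of_int (v j) * t j \<ge> 0) \<longrightarrow>
        cd_norm r (f t) < C * exp (\<Sum>j=1..n. a (v j) * t j))"


section \<open>Kernels and the transform\<close>

definition cartesian_kernel :: "nat \<Rightarrow> cd \<Rightarrow> (nat \<Rightarrow> real) \<Rightarrow> cd \<Rightarrow> cd" where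
  "cartesian_kernel n p t \<zeta> = (\<lambda>k.
     p 0 * (\<Sum>j=1..n. t j) * cd_basis 0 k + (\<Sum>j=1..n. p j * t j * cd_basis j k) + \<zeta> k)"

text \<open>For \<open>j > n\<close> the sum defining \<open>s\<^sub>j\<close> is empty, which is the convention \<open>t\<^sub>m = 0\<close> for \<open>m > n\<close>.\<close>

definition spherical_phase :: "nat \<Rightarrow> cd \<Rightarrow> (nat \<Rightarrow> real) \<Rightarrow> cd \<Rightarrow> nat \<Rightarrow> real" where
  "spherical_phase n p t \<zeta> j = p j * (\<Sum>m=j..n. t m) + \<zeta> j"

definition spherical_kernel :: "nat \<Rightarrow> nat \<Rightarrow> cd \<Rightarrow> (nat \<Rightarrow> real) \<Rightarrow> cd \<Rightarrow> cd" where
  "spherical_kernel r n p t \<zeta> =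
     (let K = 2 ^ r - 1; \<phi> = spherical_phase n p t \<zeta>;
          M = (\<lambda>k. \<phi> 1 *
                ((\<Sum>j=1..K - 1. (\<Prod>l=2..j. sin (\<phi> l)) * cos (\<phi> (j + 1)) * cd_basis j k)
                 + (\<Prod>l=2..K. sin (\<phi> l)) * cd_basis K k))
      in (\<lambda>k. p 0 * (\<Sum>j=1..n. t j) * cd_basis 0 k + M k + \<zeta> 0 * cd_basis 0 k))"

text \<open>Integrals of \<open>A\<^sub>r\<close>-valued functions are taken coordinatewise.\<close>

definition transform_integrand ::
    "nat \<Rightarrow> ((nat \<Rightarrow> real) \<Rightarrow> cd) \<Rightarrow> (cd \<Rightarrow> (nat \<Rightarrow> real) \<Rightarrow> cd \<Rightarrow> cd) \<Rightarrow> cd \<Rightarrow> cd \<Rightarrow> (nat \<Rightarrow> real) \<Rightarrow> cd" where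
  "transform_integrand r f u p \<zeta> t = cd_mult r (f t) (cd_exp r (\<lambda>k. - u p t \<zeta> k))"

definition transform_exists ::
    "nat \<Rightarrow> nat \<Rightarrow> ((nat \<Rightarrow> real) \<Rightarrow> cd) \<Rightarrow> (cd \<Rightarrow> (nat \<Rightarrow> real) \<Rightarrow> cd \<Rightarrow> cd) \<Rightarrow> cd \<Rightarrow> cd \<Rightarrow> bool" where
  "transform_exists r n f u p \<zeta> \<longleftrightarrow>
     (\<forall>k. integrable (lebesgue_n n) (\<lambda>t. transform_integrand r f u p \<zeta> t k))"

definition transform ::
    "nat \<Rightarrow> nat \<Rightarrow> ((nat \<Rightarrow> real) \<Rightarrow> cd) \<Rightarrow> (cd \<Rightarrow> (nat \<Rightarrow> real) \<Rightarrow> cd \<Rightarrow> cd) \<Rightarrow> cd \<Rightarrow> cd \<Rightarrow> cd" where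
  "transform r n f u p \<zeta> =
     (\<lambda>k. \<integral>t. transform_integrand r f u p \<zeta> t k \<partial>lebesgue_n n)"

end

theory Submission
  imports Defs
begin

text \<open>
  Replacing \<open>p\<close> by \<open>p - b\<close> subtracts the real number \<open>b (t\<^sub>1 + \<dots> + t\<^sub>n)\<close> from either kernel, because the
  imaginary parts involve only \<open>p\<^sub>j\<close> with \<open>j \<ge> 1\<close>.  Real numbers are central, so this multiplies the
  exponential by the real factor \<open>exp (b (t\<^sub>1 + \<dots> + t\<^sub>n))\<close>, which moves to \<open>f\<close> by real bilinearity
  of the product: the two integrands agree pointwise.  Both transforms exist since \<open>|exp z| = exp (Re z)\<close>,
  so that the growth condition bounds the integrand by a product of two-sided decaying exponentials
  in the single \<open>t\<^sub>j\<close>.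
\<close>

section \<open>Bilinearity, unit and coordinate bounds of the product\<close>

lemma cd_low_lin: "cd_low r (\<lambda>k. c * x k + d * y k) = (\<lambda>k. c * cd_low r x k + d * cd_low r y k)"
  by (auto simp: cd_low_def)

lemma cd_high_lin: "cd_high r (\<lambda>k. c * x k + d * y k) = (\<lambda>k. c * cd_high r x k + d * cd_high r y k)"
  by (auto simp: cd_high_def)

lemma cd_conj_lin: "cd_conj r (\<lambda>k. c * x k + d * y k) = (\<lambda>k. c * cd_conj r x k + d * cd_conj r y k)"
proof (induction r arbitrary: x y)
  case (Suc r)
  then show ?case
    by (auto simp: cd_low_lin cd_high_lin cd_join_def fun_eq_iff)
qed simp

text \<open>Linearity in the two arguments has to be proved in one induction: the doubling formula
  contains \<delta>^* \<eta> and \<delta> \<xi>, where components of the right factor stand on the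
  left. So linearity in one argument rests on linearity in both arguments one level down.\<close>

lemma cd_mult_lin:
  shows cd_mult_lin_left:
      "cd_mult r (\<lambda>k. c * x k + d * y k) z = (\<lambda>k. c * cd_mult r x z k + d * cd_mult r y z k)"
    and cd_mult_lin_right:
      "cd_mult r z (\<lambda>k. c * x k + d * y k) = (\<lambda>k. c * cd_mult r z x k + d * cd_mult r z y k)"
proof (induction r arbitrary: x y z)
  case 0
  {
    case 1
    then show ?case by (auto simp: fun_eq_iff algebra_simps)
  next
    case 2
    then show ?case by (auto simp: fun_eq_iff algebra_simps)
  }
next
  case (Suc r)
  {
    case 1
    show ?case
      by (auto simp: fun_eq_iff Let_def cd_join_def cd_low_lin cd_high_lin Suc.IH cd_conj_lin algebra_simps)
  next
    case 2
    show ?case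
      by (auto simp: fun_eq_iff Let_def cd_join_def cd_low_lin cd_high_lin Suc.IH cd_conj_lin algebra_simps)
  }
qed

lemma cd_mult_scale_left: "cd_mult r (\<lambda>k. c * x k) z = (\<lambda>k. c * cd_mult r x z k)"
  using cd_mult_lin_left[of r c x 0 x z] by simp

lemma cd_mult_scale_right: "cd_mult r z (\<lambda>k. c * x k) = (\<lambda>k. c * cd_mult r z x k)"
  using cd_mult_lin_right[of r z c x 0 x] by simp

lemma cd_mult_zero [simp]: "cd_mult r (\<lambda>k. 0) z = (\<lambda>k. 0)" "cd_mult r z (\<lambda>k. 0) = (\<lambda>k. 0)"
  using cd_mult_scale_left[of r 0 z z] cd_mult_scale_right[of r z 0 z] by simp_all

lemma cd_basis_carrier: "j < 2 ^ r \<Longrightarrow> cd_basis j \<in> cd_carrier r"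
  by (auto simp: cd_basis_def cd_carrier_def)

lemma cd_basis_0_carrier [simp]: "cd_basis 0 \<in> cd_carrier r"
  by (rule cd_basis_carrier) simp

lemma cd_conj_zero [simp]: "cd_conj r (\<lambda>k. 0) = (\<lambda>k. 0)"
  using cd_conj_lin[of r 0 "\<lambda>k. 0" 0 "\<lambda>k. 0"] by simp

lemma cd_conj_basis_0 [simp]: "cd_conj r (cd_basis 0) = cd_basis 0"
  by (simp add: cd_conj_eq fun_eq_iff) (simp add: cd_basis_def)

text \<open>The unit doubles to 1 + 0 l, and 1 and 0 are fixed by conjugation. Both unit laws go
  through one induction, since multiplying by 1 from the left produces the term \<delta> 1, which
  needs the right unit law one level down.\<close>

lemma cd_mult_one:
  assumes "z \<in> cd_carrier r"
  shows cd_mult_one_right: "cd_mult r z (cd_basis 0) = z"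
    and cd_mult_one_left: "cd_mult r (cd_basis 0) z = z"
proof -
  have "cd_mult r z (cd_basis 0) = z \<and> cd_mult r (cd_basis 0) z = z"
    using assms
  proof (induction r arbitrary: z)
    case 0
    then show ?case by (auto simp: cd_basis_def cd_carrier_def fun_eq_iff)
  next
    case (Suc r)
    have lo: "cd_low r (cd_basis 0) = cd_basis 0"
      and hi: "cd_high r (cd_basis 0) = (\<lambda>k. 0)"
      by (auto simp: cd_low_def cd_high_def cd_basis_def)
    show ?case
      using Suc.prems by (simp add: Let_def lo hi Suc.IH cd_join_low_high)
  qed
  then show "cd_mult r z (cd_basis 0) = z" "cd_mult r (cd_basis 0) z = z"
    by auto
qed

lemma cd_conj_bound:
  assumes "\<And>k. \<bar>x k\<bar> \<le> A"
  shows "\<bar>cd_conj r x k\<bar> \<le> A"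
  using assms
proof (induction r arbitrary: x k)
  case (Suc r)
  have "0 \<le> A" using Suc.prems[of 0] by linarith
  then have "\<bar>cd_low r x k\<bar> \<le> A" "\<bar>cd_high r x k\<bar> \<le> A" for k
    using Suc.prems by (auto simp: cd_low_def cd_high_def)
  then show ?case
    using Suc.IH[of "cd_low r x"] \<open>0 \<le> A\<close> by (auto simp: cd_join_def)
qed simp

text \<open>Each coordinate of a doubled product is a sum or difference of two coordinates of
  products one level down, so the constant starts at 1 and doubles with each level. Bounding
  coordinates avoids multiplicativity of the norm, which fails from \<open>r = 4\<close> on.\<close>

lemma cd_mult_bound:
  assumes "\<And>k. \<bar>x k\<bar> \<le> A" and "\<And>k. \<bar>y k\<bar> \<le> B"
  shows "\<bar>cd_mult r x y k\<bar> \<le> 2 ^ r * A * B"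
  using assms
proof (induction r arbitrary: x y A B k)
  case 0
  have "0 \<le> A" using "0.prems"(1)[of 0] by linarith
  moreover have "0 \<le> B" using "0.prems"(2)[of 0] by linarith
  ultimately show ?case
    using "0.prems" by (auto simp: abs_mult intro!: mult_mono)
next
  case (Suc r)
  have nn: "0 \<le> A" "0 \<le> B"
    using Suc.prems(1)[of 0] Suc.prems(2)[of 0] by linarith+
  have x: "\<bar>cd_low r x k\<bar> \<le> A" "\<bar>cd_high r x k\<bar> \<le> A" for k
    using Suc.prems nn by (auto simp: cd_low_def cd_high_def)
  have y: "\<bar>cd_low r y k\<bar> \<le> B" "\<bar>cd_high r y k\<bar> \<le> B" for k
    using Suc.prems nn by (auto simp: cd_low_def cd_high_def)
  have yc: "\<bar>cd_conj r (cd_low r y) k\<bar> \<le> B" "\<bar>cd_conj r (cd_high r y) k\<bar> \<le> B" for k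
    by (intro cd_conj_bound y)+
  have 1: "\<bar>cd_mult r (cd_low r x) (cd_low r y) k\<bar> \<le> 2 ^ r * A * B"
    "\<bar>cd_mult r (cd_conj r (cd_high r y)) (cd_high r x) k\<bar> \<le> 2 ^ r * B * A"
    "\<bar>cd_mult r (cd_high r y) (cd_low r x) k\<bar> \<le> 2 ^ r * B * A"
    "\<bar>cd_mult r (cd_high r x) (cd_conj r (cd_low r y)) k\<bar> \<le> 2 ^ r * A * B" for k
    by (intro Suc.IH x y yc)+
  have sum2: "\<bar>s - t\<bar> \<le> 2 ^ Suc r * A * B" "\<bar>t + s\<bar> \<le> 2 ^ Suc r * A * B"
    if "\<bar>s\<bar> \<le> 2 ^ r * A * B" "\<bar>t\<bar> \<le> 2 ^ r * B * A" for s t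
    using that by (simp_all add: mult_ac)
  show ?case
    using nn sum2 1 by (simp add: Let_def cd_join_def del: power_Suc)
qed

section \<open>Measurability of the algebra operations\<close>

lemma cd_conj_measurable:
  assumes "\<And>k. (\<lambda>t. x t k) \<in> borel_measurable M"
  shows "(\<lambda>t. cd_conj r (x t) k) \<in> borel_measurable M"
  using assms
proof (induction r arbitrary: x k)
  case (Suc r)
  have *: "(\<lambda>t. cd_low r (x t) k) \<in> borel_measurable M"
    "(\<lambda>t. cd_high r (x t) k) \<in> borel_measurable M" for k
    using Suc.prems by (simp_all add: cd_low_def cd_high_def)
  show ?case
    using * Suc.IH[of "\<lambda>t. cd_low r (x t)"]
    by (cases "k < 2 ^ r"; cases "k < 2 ^ Suc r") (simp_all add: cd_join_def)
qed simp

lemma cd_mult_measurable: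
  assumes "\<And>k. (\<lambda>t. x t k) \<in> borel_measurable M" and "\<And>k. (\<lambda>t. y t k) \<in> borel_measurable M"
  shows "(\<lambda>t. cd_mult r (x t) (y t) k) \<in> borel_measurable M"
  using assms
proof (induction r arbitrary: x y k)
  case 0
  then show ?case by simp
next
  case (Suc r)
  have *: "(\<lambda>t. cd_low r (x t) k) \<in> borel_measurable M"
    "(\<lambda>t. cd_high r (x t) k) \<in> borel_measurable M"
    "(\<lambda>t. cd_low r (y t) k) \<in> borel_measurable M"
    "(\<lambda>t. cd_high r (y t) k) \<in> borel_measurable M" for k
    using Suc.prems by (simp_all add: cd_low_def cd_high_def)
  show ?case
    using *
    by (cases "k < 2 ^ r"; cases "k < 2 ^ Suc r")
       (simp_all add: Let_def cd_join_def Suc.IH cd_conj_measurable borel_measurable_add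
         borel_measurable_diff del: power_Suc)
qed

section \<open>Powers and exponential of a single element\<close>

definition cd_Im :: "cd \<Rightarrow> cd" where
  "cd_Im z = z(0 := 0)"

definition cd_Im_norm :: "nat \<Rightarrow> cd \<Rightarrow> real" where
  "cd_Im_norm r z = sqrt (\<Sum>j<2 ^ r. (cd_Im z j)\<^sup>2)"

lemma cd_Im_carrier [simp]: "z \<in> cd_carrier r \<Longrightarrow> cd_Im z \<in> cd_carrier r"
  by (auto simp: cd_Im_def cd_carrier_def)

lemma cd_component_le_sqrt:
  assumes "z \<in> cd_carrier r"
  shows "\<bar>z k\<bar> \<le> sqrt (\<Sum>j<2 ^ r. (z j)\<^sup>2)"
proof (cases "k < 2 ^ r")
  case True
  then have "(z k)\<^sup>2 \<le> (\<Sum>j<2 ^ r. (z j)\<^sup>2)"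
    by (intro member_le_sum) auto
  then show ?thesis by (metis real_sqrt_abs real_sqrt_le_mono)
next
  case False
  then have "z k = 0" using assms by (auto simp: cd_carrier_def)
  then show ?thesis by (auto intro!: sum_nonneg)
qed

lemma cd_Im_square:
  assumes "z \<in> cd_carrier r"
  shows "cd_mult r (cd_Im z) (cd_Im z) = (\<lambda>k. - (cd_Im_norm r z)\<^sup>2 * cd_basis 0 k)"
proof -
  have "cd_Im z = (\<lambda>k. - cd_conj r (cd_Im z) k)"
    unfolding cd_conj_eq[OF cd_Im_carrier[OF assms]] by (auto simp: cd_Im_def)
  then have "cd_mult r (cd_Im z) (cd_Im z) = (\<lambda>k. - cd_mult r (cd_Im z) (cd_conj r (cd_Im z)) k)"
    using cd_mult_minus(2)[of "cd_Im z" r "cd_conj r (cd_Im z)"] assms by simp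
  moreover have "(cd_Im_norm r z)\<^sup>2 = (\<Sum>j<2 ^ r. (cd_Im z j)\<^sup>2)"
    by (simp add: cd_Im_norm_def sum_nonneg)
  ultimately show ?thesis
    using assms by (simp add: cd_mult_conj)
qed

text \<open>
  A single element generates a copy of the complex numbers, with \<open>Im z / |Im z|\<close> as imaginary unit.
  If \<open>Im z = 0\<close>, the quotient below is \<open>0\<close>, and so is the factor \<^term>\<open>cd_Im z k\<close>.
\<close>

lemma cd_power_eq:
  assumes "z \<in> cd_carrier r"
  defines "w \<equiv> Complex (z 0) (cd_Im_norm r z)"
  shows "cd_power r z m =
    (\<lambda>k. Re (w ^ m) * cd_basis 0 k + Im (w ^ m) / cd_Im_norm r z * cd_Im z k)"
proof (induction m)
  case 0
  then show ?case by simp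
next
  case (Suc m)
  define s y where "s = cd_Im_norm r z" and "y = cd_Im z"
  define \<alpha> \<beta> where "\<alpha> = Re (w ^ m)" and "\<beta> = Im (w ^ m)"
  have z: "z = (\<lambda>k. z 0 * cd_basis 0 k + 1 * y k)"
    by (auto simp: y_def cd_Im_def cd_basis_def)
  have y: "y \<in> cd_carrier r" using assms by (simp add: y_def)
  have yy: "cd_mult r y y = (\<lambda>k. - s\<^sup>2 * cd_basis 0 k)"
    using cd_Im_square[OF assms(1)] by (simp add: y_def s_def)
  have zy: "cd_mult r z y = (\<lambda>k. z 0 * y k - s\<^sup>2 * cd_basis 0 k)"
    by (subst z, subst cd_mult_lin_left) (simp add: yy cd_mult_one_left[OF y])
  have s0: "y k = 0" if "s = 0" for k
    using cd_component_le_sqrt[OF y, of k] that by (simp add: s_def y_def cd_Im_norm_def)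
  have "cd_power r z (Suc m) = cd_mult r z (\<lambda>k. \<alpha> * cd_basis 0 k + \<beta> / s * y k)"
    by (simp add: Suc.IH \<alpha>_def \<beta>_def s_def y_def)
  also have "\<dots> = (\<lambda>k. \<alpha> * z k + \<beta> / s * (z 0 * y k - s\<^sup>2 * cd_basis 0 k))"
    by (subst cd_mult_lin_right) (simp add: zy cd_mult_one_right[OF assms(1)])
  \<comment> \<open>The new coefficients are the real part of \<open>w * w ^ m\<close>, and its
    imaginary part divided by \<open>s\<close>.\<close>
  also have "\<dots> = (\<lambda>k. (z 0 * \<alpha> - s * \<beta>) * cd_basis 0 k + (z 0 * \<beta> + s * \<alpha>) / s * y k)"
  proof
    fix k
    have zk: "z k = z 0 * cd_basis 0 k + y k" by (subst z) simp
    show "\<alpha> * z k + \<beta> / s * (z 0 * y k - s\<^sup>2 * cd_basis 0 k) =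
       (z 0 * \<alpha> - s * \<beta>) * cd_basis 0 k + (z 0 * \<beta> + s * \<alpha>) / s * y k"
      unfolding zk using s0[of k]
      by (cases "s = 0") (simp_all add: field_simps power2_eq_square)
  qed
  finally show ?case
    by (simp add: w_def \<alpha>_def \<beta>_def s_def y_def)
qed

text \<open>By \<open>cd_power_eq\<close> every coordinate of the powers is a fixed real combination
  of \<open>Re (w ^ m)\<close> and \<open>Im (w ^ m)\<close>, so the series is summed by the complex
  exponential of w = Re z + i |Im z|. The result is Euler's formula in the plane spanned by 1 and Im
  z.\<close>

lemma cd_exp_eq:
  assumes "z \<in> cd_carrier r"
  shows "cd_exp r z = (\<lambda>k. exp (z 0) * (cos (cd_Im_norm r z) * cd_basis 0 k
           + sin (cd_Im_norm r z) / cd_Im_norm r z * cd_Im z k))"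
proof
  fix k
  define s where "s = cd_Im_norm r z"
  define w where "w = Complex (z 0) s"
  have "(\<lambda>m. w ^ m /\<^sub>R fact m) sums exp w"
    by (rule exp_converges)
  then have "(\<lambda>m. Re (w ^ m /\<^sub>R fact m)) sums Re (exp w)" "(\<lambda>m. Im (w ^ m /\<^sub>R fact m)) sums Im (exp w)"
    by (simp_all only: sums_Re sums_Im)
  then have "(\<lambda>m. Re (w ^ m /\<^sub>R fact m) * cd_basis 0 k + Im (w ^ m /\<^sub>R fact m) * (cd_Im z k / s))
      sums (Re (exp w) * cd_basis 0 k + Im (exp w) * (cd_Im z k / s))"
    by (intro sums_add sums_mult2)
  moreover have "(\<lambda>m. Re (w ^ m /\<^sub>R fact m) * cd_basis 0 k + Im (w ^ m /\<^sub>R fact m) * (cd_Im z k / s))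
    = (\<lambda>m. cd_power r z m k / fact m)"
    unfolding cd_power_eq[OF assms] w_def[symmetric] s_def[symmetric]
    by (simp only: scaleR_complex.sel divide_inverse distrib_left distrib_right mult_ac)
  ultimately show "cd_exp r z k = exp (z 0) * (cos (cd_Im_norm r z) * cd_basis 0 k
           + sin (cd_Im_norm r z) / cd_Im_norm r z * cd_Im z k)"
    by (simp add: cd_exp_def sums_iff w_def s_def[symmetric] Re_exp Im_exp distrib_left)
qed

text \<open>Adding a real number leaves \<open>cd_Im\<close> and \<open>cd_Im_norm\<close>
  unchanged, so in the closed form only the factor \<open>exp (z 0)\<close> changes.\<close>

lemma cd_exp_add_real:
  assumes "z \<in> cd_carrier r"
  shows "cd_exp r (\<lambda>k. z k + c * cd_basis 0 k) = (\<lambda>k. exp c * cd_exp r z k)"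
proof -
  let ?y = "\<lambda>k. z k + c * cd_basis 0 k"
  have "?y \<in> cd_carrier r"
    using assms by (auto simp: cd_carrier_def cd_basis_def)
  moreover have "cd_Im ?y = cd_Im z" by (auto simp: cd_Im_def cd_basis_def)
  moreover from this have "cd_Im_norm r ?y = cd_Im_norm r z" by (simp add: cd_Im_norm_def)
  ultimately show ?thesis
    by (simp add: cd_exp_eq assms exp_add) (simp add: cd_basis_def mult_ac)
qed

text \<open>In the closed form the cosine term lives on coordinate 0 only and the sine term off
  coordinate 0 only. It therefore suffices to bound each of them by 1; for the sine term this holds
  because a coordinate of Im z is at most |Im z|.\<close>

lemma cd_exp_bound:
  assumes "z \<in> cd_carrier r"
  shows "\<bar>cd_exp r z k\<bar> \<le> exp (z 0)"
proof -
  define s where "s = cd_Im_norm r z"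
  have "s \<ge> 0" by (simp add: s_def cd_Im_norm_def sum_nonneg)
  moreover have "\<bar>cd_Im z k\<bar> \<le> s"
    using cd_component_le_sqrt[of "cd_Im z" r k] assms by (simp add: s_def cd_Im_norm_def)
  ultimately have "\<bar>sin s / s * cd_Im z k\<bar> \<le> 1"
    using mult_mono'[of "\<bar>sin s\<bar>" 1 "\<bar>cd_Im z k\<bar>" s] by (cases "s = 0") (auto simp: abs_mult field_simps)
  then have "\<bar>cos s * cd_basis 0 k + sin s / s * cd_Im z k\<bar> \<le> 1"
    by (auto simp: cd_basis_def cd_Im_def)
  then show ?thesis
    by (simp add: cd_exp_eq[OF assms] s_def[symmetric] abs_mult)
qed

text \<open>The closed form replaces the power series by finitely many measurable
  operations.\<close>

lemma cd_exp_measurable: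
  assumes "\<And>t. t \<in> space M \<Longrightarrow> z t \<in> cd_carrier r"
    and [measurable]: "\<And>k. (\<lambda>t. z t k) \<in> borel_measurable M"
  shows "(\<lambda>t. cd_exp r (z t) k) \<in> borel_measurable M"
proof -
  have Im: "(\<lambda>t. cd_Im (z t) k) \<in> borel_measurable M" for k
    by (cases "k = 0") (simp_all add: cd_Im_def)
  have [measurable]: "(\<lambda>t. cd_Im_norm r (z t)) \<in> borel_measurable M"
    using Im unfolding cd_Im_norm_def by measurable
  note [measurable] = Im
  show ?thesis
    by (subst measurable_cong[OF fun_cong[OF cd_exp_eq[OF assms(1)]]]) (assumption, measurable)
qed

section \<open>Measurability of almost everywhere continuous functions\<close>

lemma AE_continuous_imp_measurable_completion:
  fixes f :: "'a :: t2_space \<Rightarrow> real"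
  assumes id: "(\<lambda>x. x) \<in> borel_measurable M"
    and cont: "AE x in completion M. continuous (at x within space M) f"
  shows "f \<in> borel_measurable (completion M)"
proof (rule borel_measurableI)
  fix S :: "real set"
  assume S: "open S"
  obtain N where N: "N \<in> null_sets M" "{x \<in> space M. \<not> continuous (at x within space M) f} \<subseteq> N"
    using cont[unfolded AE_completion_iff] unfolding eventually_ae_filter by (elim bexE)
  \<comment> \<open>On the space, \<open>W\<close> consists of the points near which
    \<open>f\<close> takes values in \<open>S\<close>. It contains every continuity point of
    \<open>f\<close> in the preimage of \<open>S\<close>, so the rest of that preimage lies in
    \<open>N\<close> and is measurable in the completion.\<close>
  define W where "W = \<Union>{V. open V \<and> (\<forall>y\<in>V \<inter> space M. f y \<in> S)}"
  have "open W" by (auto simp: W_def)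
  then have "(\<lambda>x. x) -` W \<inter> space M \<in> sets M"
    by (intro measurable_sets[OF id]) simp
  then have "W \<inter> space M \<in> sets (completion M)" by simp
  moreover have "f -` S \<inter> N \<inter> space M \<in> sets (completion M)"
    by (rule null_sets_completion[OF N(1)]) auto
  moreover have "f -` S \<inter> space (completion M) = (W \<inter> space M) \<union> (f -` S \<inter> N \<inter> space M)"
  proof (intro equalityI subsetI)
    fix x assume x: "x \<in> f -` S \<inter> space (completion M)"
    show "x \<in> (W \<inter> space M) \<union> (f -` S \<inter> N \<inter> space M)"
    proof (cases "x \<in> N")
      case False
      with x N(2) have "continuous (at x within space M) f" by auto
      moreover have "f x \<in> S" using x by simp
      ultimately obtain V where "open V" "x \<in> V" "\<forall>y\<in>space M. y \<in> V \<longrightarrow> f y \<in> S"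
        using S unfolding continuous_within_topological by blast
      then have "x \<in> W" unfolding W_def by blast
      then show ?thesis using x by simp
    next
      case True
      then show ?thesis using x by simp
    qed
  next
    fix x assume "x \<in> (W \<inter> space M) \<union> (f -` S \<inter> N \<inter> space M)"
    then show "x \<in> f -` S \<inter> space (completion M)"
      by (simp add: W_def) blast
  qed
  ultimately show "f -` S \<inter> space (completion M) \<in> sets (completion M)"
    by (simp only: sets.Un)
qed

lemma space_lebesgue_n: "space (lebesgue_n n) = euclid n"
  by (simp add: lebesgue_n_def euclid_def space_PiM)

lemma component_measurable_lebesgue_n:
  assumes "j \<in> {1..n}"
  shows "(\<lambda>t. t j) \<in> borel_measurable (lebesgue_n n)"
  unfolding lebesgue_n_def
  by (intro measurable_completion measurable_component_singleton[of j "{1..n}" "\<lambda>_. lborel", simplified]) (use assms in auto)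

lemma AE_continuous_imp_component_measurable:
  fixes f :: "(nat \<Rightarrow> real) \<Rightarrow> cd"
  assumes "AE t in lebesgue_n n. continuous (at t within euclid n) f"
  shows "(\<lambda>t. f t k) \<in> borel_measurable (lebesgue_n n)"
proof -
  let ?M = "PiM {1..n} (\<lambda>_. lborel) :: (nat \<Rightarrow> real) measure"
  have sp: "space ?M = euclid n" by (simp add: euclid_def space_PiM)
  \<comment> \<open>The topology of \<open>nat \<Rightarrow> real\<close> has a coordinate for every
    natural number; those outside \<open>{1..n}\<close> are constantly \<open>undefined\<close> on
    the space.\<close>
  have "(\<lambda>t. t j) \<in> borel_measurable ?M" for j
  proof (cases "j \<in> {1..n}")
    case True
    then show ?thesis
      using measurable_component_singleton[of j "{1..n}" "\<lambda>_. lborel"] by simp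
  next
    case False
    then have "t j = undefined" if "t \<in> space ?M" for t
      using that by (auto simp: space_PiM PiE_def extensional_def)
    then show ?thesis
      using measurable_cong[of ?M "\<lambda>t. t j" "\<lambda>_. undefined" borel] by simp
  qed
  then have id: "(\<lambda>t. t) \<in> borel_measurable ?M"
    by (rule measurable_coordinatewise_then_product)
  have coord: "(\<lambda>z::cd. z k) \<midarrow>z\<rightarrow> z k" for z :: cd
    using continuous_on_eq_continuous_at[THEN iffD1, OF open_UNIV continuous_on_product_coordinates]
    unfolding isCont_def by blast
  have "AE t in completion ?M. continuous (at t within space ?M) (\<lambda>t. f t k)"
    using assms unfolding lebesgue_n_def sp
    by (rule eventually_mono) (unfold continuous_within, erule tendsto_compose[OF coord])
  with id show ?thesis
    unfolding lebesgue_n_def by (rule AE_continuous_imp_measurable_completion)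
qed

section \<open>Integrable majorants of product form\<close>

lemma integrable_two_sided_exp:
  fixes \<alpha> \<beta> :: real
  assumes "\<alpha> < 0" and "0 < \<beta>"
  shows "integrable lborel (\<lambda>x. exp ((if x \<ge> 0 then \<alpha> else \<beta>) * x))"
proof -
  have half: "integrable lborel (\<lambda>x. indicator {0..} x *\<^sub>R exp (- c * x))" if "0 < c" for c :: real
  proof -
    have "set_integrable lebesgue {0..} (\<lambda>x. exp (- c * x))"
      by (intro nonnegative_absolutely_integrable_1 integrable_on_exp_minus_to_infinity that) simp
    then show ?thesis
      unfolding set_integrable_def by (subst (asm) integrable_completion) auto
  qed
  have "integrable lborel (\<lambda>x. indicator {0..} x *\<^sub>R exp (- (- \<alpha>) * x))"
    using assms by (intro half) simp
  \<comment> \<open>The left half-line is the reflection of the right one, written as the affine map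
    \<open>0 + - 1 * x\<close>.\<close>
  moreover have "integrable lborel (\<lambda>x. indicator {0..} (0 + - 1 * x) *\<^sub>R exp (- \<beta> * (0 + - 1 * x)))"
    using assms by (intro lborel_integrable_real_affine half) auto
  ultimately have "integrable lborel (\<lambda>x. indicator {0..} x *\<^sub>R exp (- (- \<alpha>) * x)
      + indicator {0..} (0 + - 1 * x) *\<^sub>R exp (- \<beta> * (0 + - 1 * x)))"
    by (rule Bochner_Integration.integrable_add)
  \<comment> \<open>At 0 both summands equal 1, so the sum dominates the integrand without being
    equal to it there.\<close>
  then show ?thesis
    by (rule Bochner_Integration.integrable_bound) (auto simp: indicator_def)
qed

lemma integrable_lebesgue_n_prod:
  fixes h :: "real \<Rightarrow> real"
  assumes "integrable lborel h"
  shows "integrable (lebesgue_n n) (\<lambda>t. \<Prod>j=1..n. h (t j))"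
proof -
  interpret product_sigma_finite "\<lambda>_::nat. lborel :: real measure" ..
  have "integrable (PiM {1..n} (\<lambda>_. lborel)) (\<lambda>t. \<Prod>j=1..n. h (t j))"
    by (intro product_integrable_prod) (auto intro: assms)
  then show ?thesis
    unfolding lebesgue_n_def by (simp add: integrable_completion)
qed

section \<open>The two kernels and the growth of originals\<close>

lemma kernel_measurable:
  assumes "u = cartesian_kernel n \<or> u = spherical_kernel r n"
  shows "(\<lambda>t. u p t \<zeta> k) \<in> borel_measurable (lebesgue_n n)"
proof -
  have [measurable]: "(\<lambda>t. \<Sum>m=j..n. t m) \<in> borel_measurable (lebesgue_n n)" if "1 \<le> j" for j
    using that by (intro borel_measurable_sum component_measurable_lebesgue_n) auto
  have ph: "(\<lambda>t. spherical_phase n p t \<zeta> j) \<in> borel_measurable (lebesgue_n n)" if "1 \<le> j" for j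
    unfolding spherical_phase_def using that by measurable
  have sin: "(\<lambda>t. sin (spherical_phase n p t \<zeta> j)) \<in> borel_measurable (lebesgue_n n)"
    and cos: "(\<lambda>t. cos (spherical_phase n p t \<zeta> j)) \<in> borel_measurable (lebesgue_n n)" if "1 \<le> j" for j
    using ph[OF that] by measurable
  have "(\<lambda>t. cartesian_kernel n p t \<zeta> k) \<in> borel_measurable (lebesgue_n n)"
    unfolding cartesian_kernel_def
    by (intro borel_measurable_add borel_measurable_times borel_measurable_sum
        component_measurable_lebesgue_n borel_measurable_const) auto
  moreover have "(\<lambda>t. spherical_kernel r n p t \<zeta> k) \<in> borel_measurable (lebesgue_n n)"
    unfolding spherical_kernel_def Let_def
    by (intro borel_measurable_add borel_measurable_times borel_measurable_sum borel_measurable_prod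
        sin cos ph
        component_measurable_lebesgue_n borel_measurable_const) auto
  ultimately show ?thesis using assms by auto
qed

lemma kernel_carrier:
  assumes "u = cartesian_kernel n \<or> u = spherical_kernel r n"
    and "2 \<le> r" and "n \<le> 2 ^ r - 1" and "\<zeta> \<in> cd_carrier r"
  shows "u p t \<zeta> \<in> cd_carrier r"
proof -
  have "(2::nat) ^ 1 \<le> 2 ^ r" using assms(2) by (intro power_increasing) auto
  then show ?thesis
    using assms(1,3,4)
    by (auto simp: cd_carrier_def cartesian_kernel_def spherical_kernel_def Let_def cd_basis_def
        intro!: sum.neutral)
qed

lemma kernel_real_part:
  assumes "u = cartesian_kernel n \<or> u = spherical_kernel r n" and "2 \<le> r"
  shows "u p t \<zeta> 0 = p 0 * (\<Sum>j=1..n. t j) + \<zeta> 0"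
proof -
  \<comment> \<open>Hence K = 2^r - 1 is at least 1, and the last spherical term, a multiple of
    \<open>cd_basis K\<close>, has no real part.\<close>
  have "(2::nat) ^ 1 \<le> 2 ^ r" using assms(2) by (intro power_increasing) auto
  then show ?thesis
    using assms(1)
    by (auto simp: cartesian_kernel_def spherical_kernel_def Let_def cd_basis_def
        intro!: sum.neutral)
qed

lemma kernel_shift:
  assumes "u = cartesian_kernel n \<or> u = spherical_kernel r n"
  shows "u (\<lambda>k. p k - b * cd_basis 0 k) t \<zeta> = (\<lambda>k. u p t \<zeta> k - b * (\<Sum>j=1..n. t j) * cd_basis 0 k)"
proof -
  have "(\<Sum>j=1..n. (p j - b * cd_basis 0 j) * t j * cd_basis j k) = (\<Sum>j=1..n. p j * t j * cd_basis j k)" for k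
    by (intro sum.cong) (auto simp: cd_basis_def)
  then have "cartesian_kernel n (\<lambda>k. p k - b * cd_basis 0 k) t \<zeta> =
      (\<lambda>k. cartesian_kernel n p t \<zeta> k - b * (\<Sum>j=1..n. t j) * cd_basis 0 k)"
    by (simp add: cartesian_kernel_def fun_eq_iff algebra_simps) (simp add: cd_basis_def)
  moreover have "spherical_kernel r n (\<lambda>k. p k - b * cd_basis 0 k) t \<zeta> =
      (\<lambda>k. spherical_kernel r n p t \<zeta> k - b * (\<Sum>j=1..n. t j) * cd_basis 0 k)"
  proof -
    \<comment> \<open>Only phases of index at least 1 enter the kernel, and the shift vanishes at
      these indices.\<close>
    have ph: "spherical_phase n (\<lambda>k. p k - b * cd_basis 0 k) t \<zeta> j = spherical_phase n p t \<zeta> j"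
      if "j \<noteq> 0" for j
      using that by (simp add: spherical_phase_def cd_basis_def)
    have "(\<Prod>l=2..j. sin (spherical_phase n (\<lambda>k. p k - b * cd_basis 0 k) t \<zeta> l)) =
        (\<Prod>l=2..j. sin (spherical_phase n p t \<zeta> l))" for j
      by (intro prod.cong) (auto simp: ph)
    then show ?thesis
      by (simp add: spherical_kernel_def Let_def fun_eq_iff ph algebra_simps) (simp add: cd_basis_def)
  qed
  ultimately show ?thesis using assms by auto
qed

text \<open>The growth condition gives one constant for each orthant. There are only finitely many
  sign patterns \<open>v\<close>, so the sum of their constants serves for all of them; the added 1
  makes it positive.\<close>

lemma original_growth:
  assumes "original r n a f"
  shows "\<exists>C>0. \<forall>t\<in>euclid n. \<forall>k.
      \<bar>f t k\<bar> \<le> C * exp (\<Sum>j=1..n. a (if t j \<ge> 0 then 1 else -1) * t j)"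
proof -
  let ?V = "{1..n} \<rightarrow>\<^sub>E {-1, 1} :: (nat \<Rightarrow> int) set"
  have "\<forall>v\<in>?V. \<exists>C>0. \<forall>t\<in>euclid n. (\<forall>j\<in>{1..n}. of_int (v j) * t j \<ge> 0) \<longrightarrow>
        cd_norm r (f t) < C * exp (\<Sum>j=1..n. a (v j) * t j)"
    using assms unfolding original_def by blast
  from bchoice[OF this] obtain C where C': "\<forall>v\<in>?V. 0 < C v \<and> (\<forall>t\<in>euclid n.
      (\<forall>j\<in>{1..n}. of_int (v j) * t j \<ge> 0) \<longrightarrow>
        cd_norm r (f t) < C v * exp (\<Sum>j=1..n. a (v j) * t j))"
    by (rule exE)
  have C: "0 < C v" if "v \<in> ?V" for v
    using C' that by blast
  have bound: "cd_norm r (f t) < C v * exp (\<Sum>j=1..n. a (v j) * t j)"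
    if "v \<in> ?V" "t \<in> euclid n" "\<forall>j\<in>{1..n}. of_int (v j) * t j \<ge> 0" for v t
    using C' that by blast
  have fin: "finite ?V" by (intro finite_PiE) auto
  show ?thesis
  proof (intro exI conjI ballI allI)
    have "0 \<le> sum C ?V" using C by (intro sum_nonneg) (auto intro: less_imp_le)
    then show "0 < 1 + sum C ?V" by simp
    fix t k assume t: "t \<in> euclid n"
    \<comment> \<open>The sign pattern of \<open>t\<close>, with the value 1 at vanishing
      coordinates, names an orthant containing \<open>t\<close>.\<close>
    define v :: "nat \<Rightarrow> int" where "v = (\<lambda>j\<in>{1..n}. if t j \<ge> 0 then 1 else -1)"
    have v: "v \<in> ?V" by (auto simp: v_def)
    have "f t \<in> cd_carrier r" using assms t by (auto simp: original_def)
    then have "\<bar>f t k\<bar> \<le> cd_norm r (f t)"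
      using cd_component_le_sqrt by (simp add: cd_norm_eq)
    also have "\<dots> \<le> C v * exp (\<Sum>j=1..n. a (v j) * t j)"
      by (intro less_imp_le bound v t) (auto simp: v_def)
    also have "\<dots> \<le> (1 + sum C ?V) * exp (\<Sum>j=1..n. a (v j) * t j)"
    proof (intro mult_right_mono)
      have "C v \<le> sum C ?V"
        by (rule member_le_sum[OF v _ fin]) (use C in \<open>auto intro: less_imp_le\<close>)
      then show "C v \<le> 1 + sum C ?V" by simp
    qed simp
    also have "(\<Sum>j=1..n. a (v j) * t j) = (\<Sum>j=1..n. a (if t j \<ge> 0 then 1 else -1) * t j)"
      by (intro sum.cong) (auto simp: v_def)
    finally show "\<bar>f t k\<bar> \<le> (1 + sum C ?V) * exp (\<Sum>j=1..n. a (if t j \<ge> 0 then 1 else -1) * t j)" .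
  qed
qed

section \<open>Existence and comparison of the transforms\<close>

lemma transform_integrand_shift:
  assumes "u = cartesian_kernel n \<or> u = spherical_kernel r n"
    and "2 \<le> r" and "n \<le> 2 ^ r - 1" and "\<zeta> \<in> cd_carrier r"
  shows "transform_integrand r f u (\<lambda>k. p k - b * cd_basis 0 k) \<zeta> =
    transform_integrand r (\<lambda>t k. exp (b * (\<Sum>j=1..n. t j)) * f t k) u p \<zeta>"
proof
  fix t
  let ?e = "b * (\<Sum>j=1..n. t j)"
  have "(\<lambda>k. - u p t \<zeta> k) \<in> cd_carrier r"
    using kernel_carrier[OF assms, of p t] by (auto simp: cd_carrier_def)
  then have "cd_exp r (\<lambda>k. - u p t \<zeta> k + ?e * cd_basis 0 k) = (\<lambda>k. exp ?e * cd_exp r (\<lambda>k. - u p t \<zeta> k) k)"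
    by (rule cd_exp_add_real)
  moreover have "(\<lambda>k. - (u p t \<zeta> k - ?e * cd_basis 0 k)) = (\<lambda>k. - u p t \<zeta> k + ?e * cd_basis 0 k)"
    by simp
  \<comment> \<open>The real factor \<open>exp ?e\<close> comes out of the right factor on one side
    and out of the left factor on the other.\<close>
  ultimately show "transform_integrand r f u (\<lambda>k. p k - b * cd_basis 0 k) \<zeta> t =
      transform_integrand r (\<lambda>t k. exp (b * (\<Sum>j=1..n. t j)) * f t k) u p \<zeta> t"
    by (simp only: transform_integrand_def kernel_shift[OF assms(1)] cd_mult_scale_left cd_mult_scale_right)
qed

text \<open>The growth of \<open>f\<close> and the decay of the exponential combine, coordinate by
  coordinate, into a product of integrable functions of one variable that dominates the
  integrand.\<close>

lemma original_transform_exists: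
  assumes "2 \<le> r" and "n \<le> 2 ^ r - 1" and orig: "original r n a f"
    and u: "u = cartesian_kernel n \<or> u = spherical_kernel r n"
    and "\<zeta> \<in> cd_carrier r" and "a 1 < p 0" and "p 0 < a (-1)"
  shows "transform_exists r n f u p \<zeta>"
  unfolding transform_exists_def
proof
  fix k
  obtain C where C: "0 < C" "\<forall>t\<in>euclid n. \<forall>k.
      \<bar>f t k\<bar> \<le> C * exp (\<Sum>j=1..n. a (if t j \<ge> 0 then 1 else -1) * t j)"
    using original_growth[OF orig] by (elim exE conjE)
  \<comment> \<open>The exponents are the growth rates of \<open>f\<close> minus Re p. The strip
    condition makes \<open>a 1 - p 0\<close> negative and \<open>a (-1) - p 0\<close> positive, so
    \<open>h\<close> decays at both ends.\<close>
  define h where "h x = exp ((if x \<ge> 0 then a 1 - p 0 else a (-1) - p 0) * x)" for x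
  define E where "E t = cd_exp r (\<lambda>k. - u p t \<zeta> k)" for t
  have car: "(\<lambda>k. - u p t \<zeta> k) \<in> cd_carrier r" for t
    using kernel_carrier[OF u assms(1,2,5), of p t] by (auto simp: cd_carrier_def)
  have "(\<lambda>t. f t k) \<in> borel_measurable (lebesgue_n n)" for k
    using orig by (intro AE_continuous_imp_component_measurable) (simp add: original_def)
  moreover have "(\<lambda>t. E t k) \<in> borel_measurable (lebesgue_n n)" for k
    unfolding E_def
    by (intro cd_exp_measurable car borel_measurable_uminus kernel_measurable[OF u])
  ultimately have meas: "(\<lambda>t. transform_integrand r f u p \<zeta> t k) \<in> borel_measurable (lebesgue_n n)"
    unfolding transform_integrand_def E_def[symmetric] by (rule cd_mult_measurable)
  have "integrable lborel h"
    unfolding h_def using assms by (intro integrable_two_sided_exp) auto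
  \<comment> \<open>The factor \<open>2 ^ r\<close> comes from \<open>cd_mult_bound\<close>,
    \<open>C\<close> from the growth of \<open>f\<close>, and \<open>exp (- \<zeta> 0)\<close> from
    the constant term in the real part of the kernel.\<close>
  then have int: "integrable (lebesgue_n n) (\<lambda>t. 2 ^ r * C * exp (- \<zeta> 0) * (\<Prod>j=1..n. h (t j)))"
    by (intro integrable_mult_right integrable_lebesgue_n_prod)
  have bound: "norm (transform_integrand r f u p \<zeta> t k) \<le>
      norm (2 ^ r * C * exp (- \<zeta> 0) * (\<Prod>j=1..n. h (t j)))" if t: "t \<in> space (lebesgue_n n)" for t
  proof -
    let ?g = "\<Sum>j=1..n. a (if t j \<ge> 0 then 1 else -1) * t j"
    let ?x = "- (p 0 * (\<Sum>j=1..n. t j) + \<zeta> 0)"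
    \<comment> \<open>The exponents of the two bounds are collected by coordinates, so that their
      exponential factors into values of \<open>h\<close>.\<close>
    have "?g + ?x = - \<zeta> 0 + (\<Sum>j=1..n. (if t j \<ge> 0 then a 1 - p 0 else a (-1) - p 0) * t j)"
    proof -
      have "(\<Sum>j=1..n. (if t j \<ge> 0 then a 1 - p 0 else a (-1) - p 0) * t j) = ?g - p 0 * (\<Sum>j=1..n. t j)"
        unfolding sum_distrib_left sum_subtractf[symmetric]
        by (intro sum.cong) (auto simp: algebra_simps)
      then show ?thesis by simp
    qed
    then have "exp ?g * exp ?x = exp (- \<zeta> 0) * (\<Prod>j=1..n. h (t j))"
      by (simp only: h_def exp_add[symmetric] exp_sum[symmetric] finite_atLeastAtMost)
    moreover have "\<bar>cd_mult r (f t) (E t) k\<bar> \<le> 2 ^ r * (C * exp ?g) * exp ?x"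
      using bspec[OF C(2), of t] t cd_exp_bound[OF car, of t]
      by (intro cd_mult_bound) (simp_all add: E_def space_lebesgue_n kernel_real_part[OF u assms(1)])
    moreover have "0 \<le> (\<Prod>j=1..n. h (t j))" by (auto simp: h_def intro!: prod_nonneg)
    ultimately show ?thesis
      using C(1) by (simp add: transform_integrand_def E_def abs_mult mult.assoc)
  qed
  show "integrable (lebesgue_n n) (\<lambda>t. transform_integrand r f u p \<zeta> t k)"
    by (rule Bochner_Integration.integrable_bound[OF int meas], rule AE_I2, rule bound)
qed

theorem theorem16:
  fixes r n :: nat and f :: "(nat \<Rightarrow> real) \<Rightarrow> cd" and a :: "int \<Rightarrow> real"
    and b :: real and u :: "cd \<Rightarrow> (nat \<Rightarrow> real) \<Rightarrow> cd \<Rightarrow> cd" and p \<zeta> :: cd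
  assumes "2 \<le> r" and "2 ^ (r - 1) \<le> n" and "n \<le> 2 ^ r - 1"
    and "original r n a f"
    and "u = cartesian_kernel n \<or> u = spherical_kernel r n"
    and "p \<in> cd_carrier r" and "\<And>m. m > n \<Longrightarrow> p m = 0"
    and "\<zeta> \<in> cd_carrier r" and "\<And>m. m > n \<Longrightarrow> \<zeta> m = 0"
    and "a (-1) + b > cd_Re r p" and "cd_Re r p > a 1 + b"
  shows "transform_exists r n (\<lambda>t k. exp (b * (\<Sum>j=1..n. t j)) * f t k) u p \<zeta> \<and>
    transform_exists r n f u (\<lambda>k. p k - b * cd_basis 0 k) \<zeta> \<and>
    transform r n (\<lambda>t k. exp (b * (\<Sum>j=1..n. t j)) * f t k) u p \<zeta> =
      transform r n f u (\<lambda>k. p k - b * cd_basis 0 k) \<zeta>"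
proof -
  have "cd_Re r p = p 0"
    using assms(6) by (simp add: cd_Re_def cd_conj_eq)
  \<comment> \<open>The shifted parameter has real part \<open>p 0 - b\<close>, which lies strictly
    between \<open>a 1\<close> and \<open>a (-1)\<close>.\<close>
  then have ex: "transform_exists r n f u (\<lambda>k. p k - b * cd_basis 0 k) \<zeta>"
    using assms by (intro original_transform_exists[where a = a]) (auto simp: cd_basis_def)
  have "transform_integrand r f u (\<lambda>k. p k - b * cd_basis 0 k) \<zeta> =
      transform_integrand r (\<lambda>t k. exp (b * (\<Sum>j=1..n. t j)) * f t k) u p \<zeta>"
    using assms by (intro transform_integrand_shift)
  \<comment> \<open>Since the integrands coincide, existence carries over to the transform of the
    weighted function, and the integrals agree.\<close>
  with ex show ?thesis
    by (simp add: transform_exists_def transform_def)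
qed

end
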